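(* Let $(X,\tau)$ be a locally convex Hausdorff topological vector space over $\mathbb{K}\in\{\mathbb{R},\mathbb{C}\}$ that is separable and submetrizable. Then its continuous dual $X'$ is separable with respect to the weak topology $\sigma(X',X)$.
   Context: $(X,\tau)$ is called submetrizable if there is a metrizable topology $\rho$ on $X$ that is coarser than $\tau$ (non-strictly, i.e. $\rho\subseteq\tau$). $\sigma(X',X)$ is the weak topology on $X'$ induced by the pairing with $X$ (the weak* topology). Convention: separability of $X'$ is understood for $\sigma(X',X)$; separability is the same for every locally convex topology on $X'$ compatible with the duality $(X,X')$ (i.e. one for which the continuous dual of $X'$ is $X$). *)

theory Defs
  imports "HOL-Analysis.Analysis"
begin

text \<open>
  The topology of a topological vector space is an explicit argument of type \<open>'a topology\<close>, not a
  type-class instance, so that several topologies on the same vector space can be compared. The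
  scalar field \<open>'k\<close> is meant to be \<open>real\<close> or \<open>complex\<close>; it carries its norm topology.
\<close>

locale topological_vector_space = vector_space sm
  for sm :: "'k::real_normed_field \<Rightarrow> 'a::ab_group_add \<Rightarrow> 'a" +
  fixes T :: "'a topology"
  assumes topspace_UNIV: "topspace T = UNIV"
    and continuous_add: "continuous_map (prod_topology T T) T (\<lambda>(x, y). x + y)"
    and continuous_scale: "continuous_map (prod_topology euclidean T) T (\<lambda>(c, x). sm c x)"

text \<open>
  The library's \<^const>\<open>convex\<close> is tied to the class \<open>real_vector\<close>; here convex combinations are
  formed with the real scalars embedded in \<open>'k\<close>.
\<close>

definition convex_wrt :: "('k::real_normed_field \<Rightarrow> 'a::ab_group_add \<Rightarrow> 'a) \<Rightarrow> 'a set \<Rightarrow> bool" where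
  "convex_wrt sm S \<longleftrightarrow>
     (\<forall>x\<in>S. \<forall>y\<in>S. \<forall>u\<ge>0. \<forall>v\<ge>0. u + v = 1 \<longrightarrow> sm (of_real u) x + sm (of_real v) y \<in> S)"

locale locally_convex_space = topological_vector_space sm T
  for sm :: "'k::real_normed_field \<Rightarrow> 'a::ab_group_add \<Rightarrow> 'a" and T :: "'a topology" +
  assumes locally_convex: "neighbourhood_base_at 0 (convex_wrt sm) T"

text \<open>The coarser metrizable topology need not be compatible with any vector space structure.\<close>

definition submetrizable_space :: "'a topology \<Rightarrow> bool" where
  "submetrizable_space T \<longleftrightarrow>
     (\<exists>R. topspace R = topspace T \<and> metrizable_space R \<and> (\<forall>U. openin R U \<longrightarrow> openin T U))"

definition continuous_dual ::
    "('k::real_normed_field \<Rightarrow> 'a::ab_group_add \<Rightarrow> 'a) \<Rightarrow> 'a topology \<Rightarrow> ('a \<Rightarrow> 'k) set" where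
  "continuous_dual sm T =
     {f. Vector_Spaces.linear sm (*) f \<and> continuous_map T euclidean f}"

text \<open>
  \<open>\<sigma>(X', X)\<close>: the coarsest topology on the dual making every evaluation \<open>f \<mapsto> f x\<close> continuous.
\<close>

definition weak_star_topology ::
    "('k::real_normed_field \<Rightarrow> 'a::ab_group_add \<Rightarrow> 'a) \<Rightarrow> 'a topology \<Rightarrow> ('a \<Rightarrow> 'k) topology" where
  "weak_star_topology sm T =
     topology_generated_by {{f \<in> continuous_dual sm T. f x \<in> U} |x U. open U}"

lemma topspace_weak_star_topology [simp]:
  "topspace (weak_star_topology sm T) = continuous_dual sm T"
  unfolding weak_star_topology_def topology_generated_by_topspace by blast

lemma continuous_map_weak_star_eval:
  "continuous_map (weak_star_topology sm T) euclidean (\<lambda>f. f x)"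
  unfolding continuous_map_def
proof (intro conjI allI impI)
  fix U :: "'b set" assume "openin euclidean U"
  then have "open U" by simp
  then show "openin (weak_star_topology sm T)
      {f \<in> topspace (weak_star_topology sm T). f x \<in> U}"
    unfolding topspace_weak_star_topology unfolding weak_star_topology_def
    by (intro topology_generated_by_Basis) blast
qed simp

end

theory Submission
  imports Defs
begin

text \<open>
  A metric coarser than the topology of \<open>X\<close> has countably many balls around \<open>0\<close> with intersection
  \<open>{0}\<close>, and by local convexity each of them contains a convex neighbourhood \<open>C n\<close> of \<open>0\<close>
  (\<open>submetrizable_imp_convex_neighbourhood_sequence\<close>).

  Given \<open>x \<noteq> 0\<close>, some \<open>C n\<close> omits \<open>x\<close>, and Hahn--Banach (\<open>Hahn_Banach_convex\<close>) provides a functional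
  that is nonzero at \<open>x\<close> and bounded on a neighbourhood determined by \<open>C n\<close>. Replacing
  these countably many neighbourhoods by their finite intersections makes them decreasing, and then
  the functionals bounded on one of them form a subspace \<open>P\<close> of the dual. It separates the points of \<open>X\<close>. By linear algebra, \<open>P\<close> contains, for every functional \<open>g\<close> and every finite set of
  points, a functional that agrees with \<open>g\<close> on that set (\<open>separating_functionals_interpolate\<close>).
  So \<open>P\<close> is weak* dense.

  It remains to see that \<open>P\<close> is weak* separable. It is the countable union of the sets of functionals
  bounded by a natural number \<open>N\<close> on one of the neighbourhoods. Such a set is equicontinuous, so on it
  the weak* topology is that of pointwise convergence on a countable dense subset of \<open>X\<close>, which is
  second countable (\<open>countable_pointwise_dense_subset\<close>). Hence it has a countable dense subset, and
  the union of these is countable and dense in the whole dual.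
\<close>

section \<open>A Hahn--Banach theorem by minimal sublinear functionals\<close>

definition sublinear_wrt :: "(real \<Rightarrow> 'a::ab_group_add \<Rightarrow> 'a) \<Rightarrow> ('a \<Rightarrow> real) \<Rightarrow> bool" where
  "sublinear_wrt sm p \<longleftrightarrow>
     (\<forall>x y. p (x + y) \<le> p x + p y) \<and> (\<forall>t\<ge>0. \<forall>x. p (sm t x) = t * p x)"

text \<open>
  Scalar multiplication is an operation and not the one of a class instance, so that a complex
  vector space can be regarded as a real one by restricting its scalars.
\<close>

locale real_scalar_space = vector_space sm
  for sm :: "real \<Rightarrow> 'a::ab_group_add \<Rightarrow> 'a"
begin

text \<open>
  One inequality suffices for homogeneity, since the other one is the same inequality for \<open>1 / t\<close>.
  Infima of sublinear functionals, for which only upper bounds come easily, are checked in this way.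
\<close>

lemma sublinear_wrtI:
  assumes add: "\<And>x y. p (x + y) \<le> p x + p y"
    and zero: "p 0 = 0"
    and scale: "\<And>t x. t > 0 \<Longrightarrow> p (sm t x) \<le> t * p x"
  shows "sublinear_wrt sm p"
proof -
  have "p (sm t x) = t * p x" if "t \<ge> 0" for t x
  proof (cases "t = 0")
    case True
    then show ?thesis by (simp add: zero)
  next
    case False
    with that have t: "t > 0" by simp
    have "p (sm (1 / t) (sm t x)) \<le> 1 / t * p (sm t x)" using t by (intro scale) simp
    then have "t * p x \<le> p (sm t x)" using t by (simp add: field_simps)
    with scale[OF t, of x] show ?thesis by simp
  qed
  with add show ?thesis by (simp add: sublinear_wrt_def)
qed

lemma sublinear_zero: "sublinear_wrt sm p \<Longrightarrow> p 0 = 0"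
  unfolding sublinear_wrt_def by (metis mult_zero_left order_refl scale_zero_left)

lemma sublinear_ge_uminus:
  assumes "sublinear_wrt sm p"
  shows "- p (- x) \<le> p x"
proof -
  have "p (x + - x) \<le> p x + p (- x)" using assms unfolding sublinear_wrt_def by blast
  then show ?thesis using sublinear_zero[OF assms] by simp
qed

text \<open>
  Subadditivity gives \<open>- p (- x) \<le> p x\<close>, so the assumed inequality makes \<open>p\<close> odd. Subadditivity at
  \<open>- x\<close> and \<open>- y\<close> then reverses subadditivity at \<open>x\<close> and \<open>y\<close>.
\<close>

lemma linear_if_sublinear_odd:
  assumes p: "sublinear_wrt sm p" and odd: "\<And>x. p (- x) \<le> - p x"
  shows "p (x + y) = p x + p y" "p (sm c x) = c * p x"
proof -
  have neg: "p (- x) = - p x" for x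
    using odd[of x] sublinear_ge_uminus[OF p, of x] by simp
  have sub: "p (x + y) \<le> p x + p y" for x y
    using p unfolding sublinear_wrt_def by blast
  show "p (x + y) = p x + p y"
    using sub[of x y] sub[of "- x" "- y"] neg[of x] neg[of y] neg[of "x + y"] by simp
  show "p (sm c x) = c * p x"
  proof (cases "c \<ge> 0")
    case True
    then show ?thesis using p unfolding sublinear_wrt_def by blast
  next
    case False
    then have "p (sm (- c) x) = - c * p x"
      using p unfolding sublinear_wrt_def by (metis linear neg_0_le_iff_le)
    then show ?thesis using neg[of "sm c x"] by simp
  qed
qed

text \<open>
  The witness is \<open>q x = inf {p (x + t y) - t p y | t \<ge> 0}\<close>: \<open>t = 0\<close> shows \<open>q \<le> p\<close>, and \<open>t = 1\<close> gives
  the bound at \<open>- y\<close>. It is the greatest choice, since a sublinear \<open>r \<le> p\<close> with this bound satisfies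
  \<open>r x \<le> r (x + t y) + t r (- y) \<le> p (x + t y) - t p y\<close>. A minimal sublinear functional
  cannot be lowered, so it satisfies the bound in every direction \<open>y\<close> and is linear.
\<close>

lemma sublinear_lowered_in_direction:
  assumes p: "sublinear_wrt sm p"
  obtains q where "sublinear_wrt sm q" "q \<le> p" "q (- y) \<le> - p y"
proof
  have sub: "p (x + z) \<le> p x + p z" for x z
    using p unfolding sublinear_wrt_def by blast
  have hom: "p (sm t x) = t * p x" if "t \<ge> 0" for t x
    using that p unfolding sublinear_wrt_def by blast
  define A where "A x t = p (x + sm t y) - t * p y" for x t
  define q where "q x = (INF t\<in>{0..}. A x t)" for x
  have low: "- p (- x) \<le> A x t" if "t \<ge> 0" for x t
    using sub[of "- x" "x + sm t y"] hom[OF that, of y]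
    by (simp add: A_def algebra_simps)
  have bdd: "bdd_below (A x ` {0..})" for x
    by (rule bdd_belowI[of _ "- p (- x)"]) (use low in auto)
  have q_le: "q x \<le> A x t" if "t \<ge> 0" for x t
    unfolding q_def using that bdd by (intro cINF_lower) auto
  have q_ge: "m \<le> q x" if "\<And>t. t \<ge> 0 \<Longrightarrow> m \<le> A x t" for m x
    unfolding q_def using that by (intro cINF_greatest) auto
  have A_add: "A (x + z) (s + t) \<le> A x s + A z t" if "s \<ge> 0" "t \<ge> 0" for x z s t
    using sub[of "x + sm s y" "z + sm t y"]
    by (simp add: A_def algebra_simps scale_left_distrib)
  show "q \<le> p"
    using q_le[of 0] by (auto simp: le_fun_def A_def)
  show "q (- y) \<le> - p y"
    using q_le[of 1 "- y"] sublinear_zero[OF p] by (simp add: A_def)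
  show "sublinear_wrt sm q"
  proof (rule sublinear_wrtI)
    fix x z
    have "q (x + z) - A z t \<le> q x" if t: "t \<ge> 0" for t
    proof (rule q_ge)
      fix s :: real assume s: "s \<ge> 0"
      show "q (x + z) - A z t \<le> A x s"
        using q_le[of "s + t" "x + z"] A_add[OF s t, of x z] s t by simp
    qed
    then have "q (x + z) - q x \<le> q z" by (intro q_ge) force
    then show "q (x + z) \<le> q x + q z" by simp
  next
    have "A 0 t = 0" if "t \<ge> 0" for t using hom[OF that] by (simp add: A_def)
    then have "0 \<le> q 0" "q 0 \<le> 0" using q_le[of 0 0] q_ge[of 0 0] by auto
    then show "q 0 = 0" by simp
  next
    fix t :: real and x assume t: "t > 0"
    have "q (sm t x) / t \<le> q x"
    proof (rule q_ge)
      fix s :: real assume s: "s \<ge> 0"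
      have "A (sm t x) (t * s) = t * A x s"
        using hom[of t "x + sm s y"] t by (simp add: A_def algebra_simps scale_right_distrib)
      with q_le[of "t * s" "sm t x"] s t show "q (sm t x) / t \<le> A x s"
        by (simp add: field_simps)
    qed
    with t show "q (sm t x) \<le> t * q x" by (simp add: field_simps)
  qed
qed

text \<open>
  The pointwise infimum is finite, because every \<open>f \<le> p\<close> satisfies \<open>- p (- x) \<le> - f (- x) \<le> f x\<close>.
  It is subadditive because two members of a chain can be replaced by the smaller one.
\<close>

lemma sublinear_chain_lower_bound:
  assumes ne: "C \<noteq> {}" and subl: "\<And>f. f \<in> C \<Longrightarrow> sublinear_wrt sm f \<and> f \<le> p"
    and chain: "\<And>f g. f \<in> C \<Longrightarrow> g \<in> C \<Longrightarrow> f \<le> g \<or> g \<le> f"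
  obtains q where "sublinear_wrt sm q" "q \<le> p" "\<And>f. f \<in> C \<Longrightarrow> q \<le> f"
proof
  define q where "q x = (INF f\<in>C. f x)" for x
  have low: "- p (- x) \<le> f x" if "f \<in> C" for f x
    using sublinear_ge_uminus[of f x] subl[OF that] le_funD[of f p "- x"] by linarith
  have bdd: "bdd_below ((\<lambda>f. f x) ` C)" for x
    by (rule bdd_belowI[of _ "- p (- x)"]) (use low in auto)
  have q_le: "q x \<le> f x" if "f \<in> C" for x f
    unfolding q_def using that bdd by (intro cINF_lower) auto
  have q_ge: "m \<le> q x" if "\<And>f. f \<in> C \<Longrightarrow> m \<le> f x" for m x
    unfolding q_def using that ne by (intro cINF_greatest) auto
  show q_lb: "q \<le> f" if "f \<in> C" for f using q_le[OF that] by (simp add: le_fun_def)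
  show "q \<le> p" using ne q_lb subl by (meson all_not_in_conv order_trans)
  show "sublinear_wrt sm q"
  proof (rule sublinear_wrtI)
    fix x z
    have pair: "q (x + z) \<le> f x + g z" if fg: "f \<in> C" "g \<in> C" for f g
    proof -
      obtain h where h: "h \<in> C" "h \<le> f" "h \<le> g" using chain[OF fg] fg by blast
      have "h (x + z) \<le> h x + h z" using subl[OF h(1)] unfolding sublinear_wrt_def by blast
      with q_le[OF h(1), of "x + z"] le_funD[OF h(2), of x] le_funD[OF h(3), of z]
      show ?thesis by linarith
    qed
    have "q (x + z) - g z \<le> q x" if "g \<in> C" for g
      using pair[OF _ that] by (intro q_ge) (simp add: algebra_simps)
    then have "q (x + z) - q x \<le> q z" by (intro q_ge) force
    then show "q (x + z) \<le> q x + q z" by simp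
  next
    have "f 0 = 0" if "f \<in> C" for f using subl[OF that] sublinear_zero by blast
    then have "(\<lambda>f. f 0) ` C = {0}" using ne by force
    then show "q 0 = 0" unfolding q_def by simp
  next
    fix t :: real and x assume t: "t > 0"
    have "q (sm t x) / t \<le> q x"
    proof (rule q_ge)
      fix f assume f: "f \<in> C"
      then have "f (sm t x) = t * f x"
        using subl[OF f] t unfolding sublinear_wrt_def by simp
      with q_le[OF f, of "sm t x"] t show "q (sm t x) / t \<le> f x" by (simp add: field_simps)
    qed
    with t show "q (sm t x) \<le> t * q x" by (simp add: field_simps)
  qed
qed

text \<open>
  Zorn's lemma yields a minimal sublinear functional below \<open>p\<close>, and minimality makes it linear. The
  search starts from \<open>p\<close> lowered in direction \<open>x0\<close>: any linear functional below that one is at most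
  \<open>- p x0\<close> at \<open>- x0\<close>, which forces equality at \<open>x0\<close>.
\<close>

theorem Hahn_Banach_dominated:
  assumes p: "sublinear_wrt sm p"
  obtains f where "\<And>x y. f (x + y) = f x + f y" "\<And>c x. f (sm c x) = c * f x"
    "\<And>x. f x \<le> p x" "f x0 = p x0"
proof -
  obtain p0 where p0: "sublinear_wrt sm p0" "p0 \<le> p" "p0 (- x0) \<le> - p x0"
    using sublinear_lowered_in_direction[OF p] by blast
  define A where "A = {q. sublinear_wrt sm q \<and> q \<le> p0}"
  \<comment> \<open>Zorn's lemma produces maximal elements, so the pointwise order is reversed.\<close>
  let ?P = "\<lambda>f g :: 'a \<Rightarrow> real. g \<le> f"
  have "\<exists>m\<in>A. \<forall>a\<in>A. ?P m a \<longrightarrow> a = m"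
  proof (rule predicate_Zorn)
    show "partial_order_on A (relation_of ?P A)"
      unfolding partial_order_on_def preorder_on_def refl_on_def trans_def antisym_def relation_of_def
      by auto
  next
    fix C assume C: "C \<in> Chains (relation_of ?P A)"
    show "\<exists>u\<in>A. \<forall>a\<in>C. ?P a u"
    proof (cases "C = {}")
      case True
      then show ?thesis using p0(1) by (auto simp: A_def)
    next
      case False
      have "f \<in> A" if "f \<in> C" for f
        using C that unfolding Chains_def relation_of_def by blast
      then have subl: "sublinear_wrt sm f \<and> f \<le> p0" if "f \<in> C" for f
        using that unfolding A_def by blast
      have chain: "f \<le> g \<or> g \<le> f" if "f \<in> C" "g \<in> C" for f g
        using C that unfolding Chains_def relation_of_def by blast
      show ?thesis
        using sublinear_chain_lower_bound[OF False subl chain]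
        unfolding A_def by (metis (mono_tags, lifting) mem_Collect_eq)
    qed
  qed
  then obtain f where f: "sublinear_wrt sm f" "f \<le> p0"
    and min: "\<And>q. sublinear_wrt sm q \<Longrightarrow> q \<le> f \<Longrightarrow> q = f"
    unfolding A_def by (auto intro: order_trans)
  have odd: "f (- y) \<le> - f y" for y
    using sublinear_lowered_in_direction[OF f(1), of y] min by metis
  have le: "f x \<le> p x" for x
    using f(2) p0(2) by (meson le_funD order_trans)
  have "p x0 \<le> f x0"
    using sublinear_ge_uminus[OF f(1), of x0] le_funD[OF f(2), of "- x0"] p0(3) by linarith
  with le[of x0] have "f x0 = p x0" by simp
  with that[of f] linear_if_sublinear_odd[OF f(1) odd] le show thesis by blast
qed

text \<open>
  The Minkowski functional. The infimum is meaningful only for absorbing sets; for other sets it may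
  run over the empty set.
\<close>

definition gauge_wrt :: "'a set \<Rightarrow> 'a \<Rightarrow> real" where
  "gauge_wrt C x = Inf {t. t > 0 \<and> sm (1 / t) x \<in> C}"

text \<open>
  The gauge of a convex absorbing set \<open>C\<close> is sublinear, at most \<open>1\<close> on \<open>C\<close> and at least \<open>1\<close> off \<open>C\<close>.
  A linear functional below the gauge that agrees with it at \<open>x0\<close> is therefore as required.
\<close>

lemma Hahn_Banach_convex:
  assumes conv: "convex_wrt sm C" and zero: "0 \<in> C"
    and absorb: "\<And>x. \<exists>t>0. sm (1 / t) x \<in> C"
    and notin: "x0 \<notin> C"
  obtains f where "\<And>x y. f (x + y) = f x + f y" "\<And>c x. f (sm c x) = c * f x"
    "\<And>x. x \<in> C \<Longrightarrow> f x \<le> 1" "f x0 \<noteq> (0::real)"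
proof -
  let ?S = "\<lambda>x. {t. t > 0 \<and> sm (1 / t) x \<in> C}"
  let ?p = "gauge_wrt C"
  have convD: "sm u x + sm v y \<in> C" if "x \<in> C" "y \<in> C" "u \<ge> 0" "v \<ge> 0" "u + v = 1" for x y u v
    using conv that unfolding convex_wrt_def by simp
  have ne: "?S x \<noteq> {}" for x using absorb[of x] by auto
  have bdd: "bdd_below (?S x)" for x by (rule bdd_belowI[of _ 0]) auto
  have p_le: "?p x \<le> t" if "t > 0" "sm (1 / t) x \<in> C" for x t
    unfolding gauge_wrt_def using that bdd by (intro cInf_lower) auto
  have p_ge: "m \<le> ?p x" if "\<And>t. t > 0 \<Longrightarrow> sm (1 / t) x \<in> C \<Longrightarrow> m \<le> t" for m x
    unfolding gauge_wrt_def using that ne by (intro cInf_greatest) auto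
  have p_one: "?p x \<le> 1" if "x \<in> C" for x
    using p_le[of 1 x] that by simp
  have add: "sm (1 / (s + t)) (x + y) \<in> C"
    if s: "s > 0" "sm (1 / s) x \<in> C" and t: "t > 0" "sm (1 / t) y \<in> C" for s t x y
  proof -
    \<comment> \<open>The point \<open>(x + y) / (s + t)\<close> is a convex combination of \<open>x / s\<close> and \<open>y / t\<close>.\<close>
    have "sm (s / (s + t)) (sm (1 / s) x) + sm (t / (s + t)) (sm (1 / t) y) \<in> C"
      using s t by (intro convD) (auto simp flip: add_divide_distrib)
    then show ?thesis using s t by (simp add: scale_right_distrib)
  qed
  have "sublinear_wrt sm ?p"
  proof (rule sublinear_wrtI)
    fix x y
    have "?p (x + y) - t \<le> ?p x" if t: "t > 0" "sm (1 / t) y \<in> C" for t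
    proof (rule p_ge)
      fix s assume s: "s > 0" "sm (1 / s) x \<in> C"
      show "?p (x + y) - t \<le> s" using p_le[OF _ add[OF s t]] s t by simp
    qed
    then have "?p (x + y) - ?p x \<le> ?p y" by (intro p_ge) force
    then show "?p (x + y) \<le> ?p x + ?p y" by simp
  next
    have "0 \<le> ?p 0" by (rule p_ge) simp
    moreover have "?p 0 \<le> e" if "e > 0" for e using p_le[of e 0] that zero by simp
    ultimately show "?p 0 = 0" by (meson dense_ge order_antisym)
  next
    fix t :: real and x assume t: "t > 0"
    have "?p (sm t x) / t \<le> ?p x"
    proof (rule p_ge)
      fix s :: real assume s: "s > 0" "sm (1 / s) x \<in> C"
      have "?p (sm t x) \<le> t * s" using s t by (intro p_le) auto
      with t show "?p (sm t x) / t \<le> s" by (simp add: field_simps)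
    qed
    with t show "?p (sm t x) \<le> t * ?p x" by (simp add: field_simps)
  qed
  then obtain f where f: "\<And>x y. f (x + y) = f x + f y" "\<And>c x. f (sm c x) = c * f x"
    "\<And>x. f x \<le> ?p x" "f x0 = ?p x0"
    using Hahn_Banach_dominated by metis
  have "1 \<le> ?p x0"
  proof (rule p_ge, rule ccontr)
    fix t :: real assume t: "t > 0" "sm (1 / t) x0 \<in> C" and "\<not> 1 \<le> t"
    \<comment> \<open>If \<open>t < 1\<close>, then \<open>x0\<close> lies on the segment from \<open>0\<close> to \<open>x0 / t\<close>, hence in \<open>C\<close>.\<close>
    then have "sm t (sm (1 / t) x0) + sm (1 - t) 0 \<in> C"
      using zero by (intro convD) auto
    with t notin show False by simp
  qed
  show thesis
  proof (rule that[of f])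
    show "f x \<le> 1" if "x \<in> C" for x using f(3)[of x] p_one[OF that] by linarith
    show "f x0 \<noteq> 0" using f(4) \<open>1 \<le> ?p x0\<close> by simp
  qed (use f in auto)
qed

end

section \<open>Separating spaces of functionals interpolate\<close>

lemma vector_space_mult: "vector_space ((*) :: 'k::field \<Rightarrow> 'k \<Rightarrow> 'k)"
  by unfold_locales (auto simp: algebra_simps)

text \<open>
  To vanish at a further point \<open>c\<close> as well, a functional \<open>h\<close> is corrected by a multiple of a functional
  \<open>k\<close> that vanishes on \<open>B\<close> and not at \<open>c\<close>. The corrected value at \<open>b\<close> is the value of \<open>h\<close> at
  \<open>b - (k b / k c) c\<close>, a point that is still outside the span of \<open>B\<close>, so \<open>h\<close> can be taken nonzero there.
\<close>

lemma (in vector_space) separating_functional_vanishing_on_finite_set: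
  assumes lin: "\<And>f. f \<in> P \<Longrightarrow> Vector_Spaces.linear scale (*) f"
    and comb: "\<And>f g c. f \<in> P \<Longrightarrow> g \<in> P \<Longrightarrow> (\<lambda>x. f x + c * g x) \<in> P"
    and sep: "\<And>x. x \<noteq> 0 \<Longrightarrow> \<exists>f\<in>P. f x \<noteq> 0"
    and "finite B" "b \<notin> span B"
  shows "\<exists>h\<in>P. (\<forall>x\<in>B. h x = 0) \<and> h b \<noteq> 0"
  using assms(4,5)
proof (induction B arbitrary: b rule: finite_induct)
  case empty
  then show ?case using sep[of b] by simp
next
  case (insert c B)
  show ?case
  proof (cases "c \<in> span B")
    case True
    then have eq: "span (insert c B) = span B" by (rule span_redundant)
    with insert.prems obtain h where h: "h \<in> P" "\<forall>x\<in>B. h x = 0" "h b \<noteq> 0"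
      using insert.IH by metis
    interpret h: Vector_Spaces.linear scale "(*)" h using lin h(1) by blast
    have "h c = 0" using h.eq_0_on_span[of B] True h(2) by blast
    with h show ?thesis by auto
  next
    case False
    then obtain k where k: "k \<in> P" "\<forall>x\<in>B. k x = 0" "k c \<noteq> 0" using insert.IH by blast
    define b' where "b' = b - scale (k b / k c) c"
    have "b' \<notin> span B"
      using insert.prems unfolding b'_def by (metis span_breakdown_eq)
    then obtain h where h: "h \<in> P" "\<forall>x\<in>B. h x = 0" "h b' \<noteq> 0" using insert.IH by blast
    interpret h: Vector_Spaces.linear scale "(*)" h using lin h(1) by blast
    have "h b + (- h c / k c) * k b \<noteq> 0"
      using h(3) k(3) by (simp add: b'_def h.diff h.scale field_simps)
    then show ?thesis
      using comb[OF h(1) k(1), of "- h c / k c"] h(2) k(2,3)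
      by (intro bexI[of _ "\<lambda>x. h x + (- h c / k c) * k x"]) auto
  qed
qed

text \<open>
  This is the algebraic reason why a separating subspace \<open>P\<close> of the dual is weak* dense: agreement on
  finitely many points is the strongest closeness that a basic weak* neighbourhood can ask for. At a
  new point in the span of the old ones the value is already correct, by linearity; at any other
  point it can be adjusted freely.
\<close>

lemma (in vector_space) separating_functionals_interpolate:
  assumes lin: "\<And>f. f \<in> P \<Longrightarrow> Vector_Spaces.linear scale (*) f"
    and zero: "(\<lambda>_. 0) \<in> P"
    and comb: "\<And>f g c. f \<in> P \<Longrightarrow> g \<in> P \<Longrightarrow> (\<lambda>x. f x + c * g x) \<in> P"
    and sep: "\<And>x. x \<noteq> 0 \<Longrightarrow> \<exists>f\<in>P. f x \<noteq> 0"
    and g: "Vector_Spaces.linear scale (*) g" and "finite B"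
  shows "\<exists>f\<in>P. \<forall>x\<in>B. f x = g x"
  using \<open>finite B\<close>
proof (induction B rule: finite_induct)
  case empty
  then show ?case using zero by auto
next
  case (insert b B)
  then obtain f where f: "f \<in> P" "\<forall>x\<in>B. f x = g x" by blast
  show ?case
  proof (cases "b \<in> span B")
    case True
    interpret vector_space_pair scale "(*) :: 'a \<Rightarrow> 'a \<Rightarrow> 'a" ..
    have "f b = g b"
      using linear_eq_on[OF lin[OF f(1)] g True] f(2) by blast
    with f show ?thesis by auto
  next
    case False
    then obtain h where h: "h \<in> P" "\<forall>x\<in>B. h x = 0" "h b \<noteq> 0"
      using separating_functional_vanishing_on_finite_set[OF lin comb sep] insert.hyps by blast
    then show ?thesis
      using comb[OF f(1) h(1), of "(g b - f b) / h b"] f(2)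
      by (intro bexI[of _ "\<lambda>x. f x + (g b - f b) / h b * h x"]) auto
  qed
qed

section \<open>Equicontinuous sets of functionals\<close>

text \<open>
  For \<open>N > 0\<close> this is \<open>N\<close> times the absolute polar of \<open>U\<close> in the algebraic dual. Continuity is
  automatic if \<open>U\<close> is a neighbourhood of \<open>0\<close>.
\<close>

definition bounded_functionals ::
    "('k::real_normed_field \<Rightarrow> 'a::ab_group_add \<Rightarrow> 'a) \<Rightarrow> 'a set \<Rightarrow> real \<Rightarrow> ('a \<Rightarrow> 'k) set" where
  "bounded_functionals sm U N =
     {f. Vector_Spaces.linear sm (*) f \<and> (\<forall>x\<in>U. norm (f x) \<le> N)}"

context topological_vector_space
begin

lemma continuous_map_scale_translate: "continuous_map T T (\<lambda>y. sm c (y + a))"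
proof -
  have "continuous_map T (prod_topology T T) (\<lambda>y. (y, a))"
    by (simp add: continuous_map_paired topspace_UNIV)
  from continuous_map_compose[OF this continuous_add]
  have add: "continuous_map T T (\<lambda>y. y + a)" by (simp add: o_def)
  have "continuous_map T (prod_topology euclidean T) (\<lambda>y. (c, y + a))"
    using add by (simp add: continuous_map_paired)
  from continuous_map_compose[OF this continuous_scale]
  show ?thesis by (simp add: o_def)
qed

lemma openin_vimage_scale_translate:
  assumes "openin T W"
  shows "openin T {y. sm c (y + a) \<in> W}"
  using openin_continuous_map_preimage[OF continuous_map_scale_translate assms]
  by (simp add: topspace_UNIV)

text \<open>
  Scalars enter as \<open>1 / t\<close>, the form in which the gauge of a set measures points.
\<close>

lemma absorbing_zero_neighbourhood:
  assumes "openin T W" "0 \<in> W"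
  shows "\<exists>t>0. sm (of_real (1 / t)) x \<in> W"
proof -
  have "continuous_map euclidean (prod_topology euclidean T) (\<lambda>c::'k. (c, x))"
    by (simp add: continuous_map_paired topspace_UNIV)
  from continuous_map_compose[OF this continuous_scale]
  have "continuous_map euclidean T (\<lambda>c. sm c x)" by (simp add: o_def)
  from openin_continuous_map_preimage[OF this assms(1)]
  have "open {c. sm c x \<in> W}" by simp
  moreover have "0 \<in> {c. sm c x \<in> W}" using assms(2) by simp
  ultimately obtain e where e: "e > 0" "\<And>c. dist c 0 < e \<Longrightarrow> sm c x \<in> W"
    unfolding open_dist by blast
  have "norm (of_real (1 / (2 / e)) :: 'k) = \<bar>1 / (2 / e)\<bar>" by (rule norm_of_real)
  then have "dist (of_real (1 / (2 / e)) :: 'k) 0 < e"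
    using e(1) by (simp only: dist_norm diff_zero) simp
  with e show ?thesis by (intro exI[of _ "2 / e"]) auto
qed

text \<open>
  The neighbourhood \<open>x + (1 / c) W\<close> with \<open>N < c e\<close> serves all \<open>f\<close> at once, because
  \<open>c (f y - f x) = f (c (y - x))\<close> has norm at most \<open>N\<close> if \<open>c (y - x)\<close> lies in \<open>W\<close>.
\<close>

lemma bounded_functionals_equicontinuous:
  assumes W: "openin T W" "0 \<in> W" and e: "e > 0"
  obtains V where "openin T V" "x \<in> V"
    "\<And>f y. f \<in> bounded_functionals sm W N \<Longrightarrow> y \<in> V \<Longrightarrow> norm (f y - f x) < e"
proof
  \<comment> \<open>The summand \<open>1\<close> makes \<open>N < c e\<close> strict, and the absolute value makes \<open>c\<close> positive for every \<open>N\<close>.\<close>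
  define c where "c = (\<bar>N\<bar> + 1) / e"
  have c: "c > 0" using e by (simp add: c_def)
  let ?V = "{y. sm (of_real c) (y + - x) \<in> W}"
  show "openin T ?V" by (rule openin_vimage_scale_translate[OF W(1)])
  show "x \<in> ?V" using W(2) by simp
  fix f y assume f: "f \<in> bounded_functionals sm W N" and y: "y \<in> ?V"
  interpret f: Vector_Spaces.linear sm "(*)" f
    using f unfolding bounded_functionals_def by blast
  have "norm (f (sm (of_real c) (y + - x))) \<le> N"
    using f y unfolding bounded_functionals_def by blast
  then have "c * norm (f y - f x) \<le> N"
    using c by (simp add: f.scale f.diff norm_mult)
  also have "N < c * e" using e by (simp add: c_def)
  finally show "norm (f y - f x) < e" using c by simp
qed

lemma bounded_functionals_subset_dual:
  assumes W: "openin T W" "0 \<in> W"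
  shows "bounded_functionals sm W N \<subseteq> continuous_dual sm T"
proof
  fix f assume f: "f \<in> bounded_functionals sm W N"
  have "openin T {x \<in> topspace T. f x \<in> Z}" if "open Z" for Z
  proof (subst openin_subopen, intro ballI)
    fix x assume "x \<in> {x \<in> topspace T. f x \<in> Z}"
    then obtain e where e: "e > 0" "\<And>z. dist z (f x) < e \<Longrightarrow> z \<in> Z"
      using \<open>open Z\<close> unfolding open_dist by blast
    obtain V where "openin T V" "x \<in> V" "\<And>y. y \<in> V \<Longrightarrow> norm (f y - f x) < e"
      using bounded_functionals_equicontinuous[OF W e(1)] f by metis
    with e show "\<exists>V. openin T V \<and> x \<in> V \<and> V \<subseteq> {x \<in> topspace T. f x \<in> Z}"
      by (intro exI[of _ V]) (auto simp: topspace_UNIV dist_norm)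
  qed
  then show "f \<in> continuous_dual sm T"
    using f unfolding continuous_dual_def bounded_functionals_def continuous_map_def by auto
qed

end

lemma weak_star_open_contains:
  assumes "openin (weak_star_topology sm T) W" "g \<in> W"
  shows "\<exists>B e. finite B \<and> e > 0 \<and>
           (\<forall>f\<in>continuous_dual sm T. (\<forall>x\<in>B. norm (f x - g x) < e) \<longrightarrow> f \<in> W)"
proof -
  have "generate_topology_on {{f \<in> continuous_dual sm T. f x \<in> U} |x U. open U} W"
    using assms(1) unfolding weak_star_topology_def by (rule openin_topology_generated_by)
  then show ?thesis using assms(2)
  proof induction
    case Empty
    then show ?case by simp
  next
    case (Int W1 W2)
    obtain B1 e1 where 1: "finite B1" "e1 > 0"
      "\<forall>f\<in>continuous_dual sm T. (\<forall>x\<in>B1. norm (f x - g x) < e1) \<longrightarrow> f \<in> W1"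
      using Int.IH(1)[OF IntD1[OF Int.prems]] by (elim exE conjE)
    obtain B2 e2 where 2: "finite B2" "e2 > 0"
      "\<forall>f\<in>continuous_dual sm T. (\<forall>x\<in>B2. norm (f x - g x) < e2) \<longrightarrow> f \<in> W2"
      using Int.IH(2)[OF IntD2[OF Int.prems]] by (elim exE conjE)
    show ?case using 1 2
      by (intro exI[of _ "B1 \<union> B2"] exI[of _ "min e1 e2"]) auto
  next
    case (UN K)
    then obtain k where "k \<in> K" "g \<in> k" by blast
    obtain B e where "finite B" "e > 0"
      "\<forall>f\<in>continuous_dual sm T. (\<forall>x\<in>B. norm (f x - g x) < e) \<longrightarrow> f \<in> k"
      using UN.IH[OF \<open>k \<in> K\<close> \<open>g \<in> k\<close>] by (elim exE conjE)
    then show ?case using \<open>k \<in> K\<close> by (intro exI[of _ B] exI[of _ e]) auto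
  next
    case (Basis S)
    then obtain x U where S: "S = {f \<in> continuous_dual sm T. f x \<in> U}" "open U" by blast
    with Basis.prems obtain e where "e > 0" "\<And>z. dist z (g x) < e \<Longrightarrow> z \<in> U"
      unfolding open_dist by blast
    then show ?case
      unfolding S by (intro exI[of _ "{x}"] exI[of _ e]) (auto simp: dist_norm)
  qed
qed

section \<open>Countable pointwise dense subsets\<close>

definition pointwise_dense_in :: "('a \<Rightarrow> 'k::real_normed_vector) set \<Rightarrow> ('a \<Rightarrow> 'k) set \<Rightarrow> bool" where
  "pointwise_dense_in S F \<longleftrightarrow> S \<subseteq> F \<and>
     (\<forall>g\<in>F. \<forall>B e. finite B \<longrightarrow> e > 0 \<longrightarrow> (\<exists>f\<in>S. \<forall>x\<in>B. norm (f x - g x) < e))"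

text \<open>
  The hypothesis on \<open>D\<close> says that every point can be replaced by a point of \<open>D\<close>, uniformly over \<open>F\<close>;
  for an equicontinuous family any dense set has this property. Closeness on finitely many points
  of \<open>D\<close> then controls closeness on finitely many arbitrary points, and restriction to a countable \<open>D\<close>
  maps \<open>F\<close> into the second countable space of sequences.
\<close>

lemma countable_pointwise_dense_subset:
  fixes F :: "('a \<Rightarrow> 'k::{real_normed_vector, second_countable_topology}) set"
  assumes D: "countable D"
    and appr: "\<And>x e. e > 0 \<Longrightarrow> \<exists>d\<in>D. \<forall>f\<in>F. norm (f d - f x) < e"
  shows "\<exists>S. countable S \<and> pointwise_dense_in S F"
proof -
  define \<Phi> :: "('a \<Rightarrow> 'k) \<Rightarrow> nat \<Rightarrow> 'k" where "\<Phi> f n = f (from_nat_into D n)" for f n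
  obtain \<B> :: "(nat \<Rightarrow> 'k) set set" where \<B>: "countable \<B>" "topological_basis \<B>"
    using ex_countable_basis by (elim exE conjE)
  \<comment> \<open>One functional is selected for each basic open set of sequences that meets the image of \<open>F\<close>.\<close>
  define pick where "pick b = (SOME f. f \<in> F \<and> \<Phi> f \<in> b)" for b
  define S where "S = pick ` {b \<in> \<B>. \<exists>f\<in>F. \<Phi> f \<in> b}"
  have pick: "pick b \<in> F \<and> \<Phi> (pick b) \<in> b" if "\<exists>f\<in>F. \<Phi> f \<in> b" for b
    using someI_ex[of "\<lambda>f. f \<in> F \<and> \<Phi> f \<in> b"] that unfolding pick_def by blast
  have "countable S" using \<B>(1) by (auto simp: S_def intro: countable_subset)
  moreover have "pointwise_dense_in S F"
    unfolding pointwise_dense_in_def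
  proof (intro conjI ballI allI impI)
    show "S \<subseteq> F" using pick by (auto simp: S_def)
    fix g and B :: "'a set" and e :: real assume g: "g \<in> F" and B: "finite B" and e: "e > 0"
    have "\<exists>n. \<forall>f\<in>F. norm (f (from_nat_into D n) - f x) < e / 3" for x
      using appr[of "e / 3" x] e from_nat_into_surj[OF D] by fastforce
    then obtain n where n: "norm (f (from_nat_into D (n x)) - f x) < e / 3" if "f \<in> F" for x f
      by metis
    define O' where "O' = {h. \<forall>x\<in>B. h (n x) \<in> ball (\<Phi> g (n x)) (e / 3)}"
    have "open O'" unfolding O'_def by (rule product_topology_basis'[OF B]) simp
    moreover have "\<Phi> g \<in> O'" using e by (simp add: O'_def)
    ultimately obtain b where b: "b \<in> \<B>" "\<Phi> g \<in> b" "b \<subseteq> O'"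
      by (rule topological_basisE[OF \<B>(2)])
    then have p: "pick b \<in> S" "pick b \<in> F" "\<Phi> (pick b) \<in> O'" using g pick[of b] by (auto simp: S_def)
    have "norm (pick b x - g x) < e" if x: "x \<in> B" for x
    proof -
      let ?d = "from_nat_into D (n x)"
      have "norm (pick b ?d - g ?d) < e / 3"
        using p(3) x by (auto simp: O'_def \<Phi>_def dist_norm norm_minus_commute)
      moreover have "norm (pick b ?d - pick b x) < e / 3" "norm (g ?d - g x) < e / 3"
        using n p(2) g by auto
      moreover have "norm (pick b x - g x) \<le>
          norm (pick b ?d - g ?d) + norm (pick b ?d - pick b x) + norm (g ?d - g x)"
        by norm
      ultimately show ?thesis by linarith
    qed
    with p(1) show "\<exists>f\<in>S. \<forall>x\<in>B. norm (f x - g x) < e" by blast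
  qed
  ultimately show ?thesis by blast
qed

section \<open>Separability of the weak* topology\<close>

text \<open>
  The functionals bounded on one of the finite intersections \<open>V n\<close> of the given neighbourhoods form a
  separating subspace \<open>P\<close> of the dual, which is weak* dense by interpolation. On the other hand \<open>P\<close> is
  a countable union of equicontinuous sets \<open>F n N\<close>, each with a countable pointwise dense subset.
\<close>

theorem separable_weak_star_if_separating_neighbourhoods:
  fixes sm :: "'k::{real_normed_field, second_countable_topology} \<Rightarrow> 'a::ab_group_add \<Rightarrow> 'a"
    and W :: "nat \<Rightarrow> 'a set"
  assumes "topological_vector_space sm T" and sepT: "separable_space T"
    and W: "\<And>n. openin T (W n)" "\<And>n. 0 \<in> W n"
    and sep: "\<And>x. x \<noteq> 0 \<Longrightarrow> \<exists>n N. \<exists>f\<in>bounded_functionals sm (W n) N. f x \<noteq> 0"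
  shows "separable_space (weak_star_topology sm T)"
proof -
  interpret topological_vector_space sm T by fact
  \<comment> \<open>Decreasing neighbourhoods make the sets \<open>F n N\<close> directed, so that their union is a subspace.\<close>
  define V where "V n = (\<Inter>i\<le>n. W i)" for n
  have V: "openin T (V n)" "0 \<in> V n" for n
    using W by (auto simp: V_def)
  define F where "F n N = bounded_functionals sm (V n) (real N)" for n N
  have F_mono: "F m M \<subseteq> F n N" if "m \<le> n" "M \<le> N" for m n M N
  proof -
    have V_sub: "V n \<subseteq> V m" using that(1) unfolding V_def by force
    have "norm (f x) \<le> real N" if "f \<in> F m M" "x \<in> V n" for f x
    proof -
      have "norm (f x) \<le> real M"
        using that V_sub unfolding F_def bounded_functionals_def by blast
      with \<open>M \<le> N\<close> show ?thesis by linarith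
    qed
    then show ?thesis unfolding F_def bounded_functionals_def by blast
  qed
  have F_dual: "F n N \<subseteq> continuous_dual sm T" for n N
    unfolding F_def by (rule bounded_functionals_subset_dual[OF V])
  define P where "P = (\<Union>n N. F n N)"
  have P_lin: "Vector_Spaces.linear sm (*) f" if "f \<in> P" for f
    using that by (auto simp: P_def F_def bounded_functionals_def)
  have P_zero: "(\<lambda>_. 0) \<in> P"
  proof -
    have "(\<lambda>_. 0) \<in> F 0 0"
      using vector_space_mult vector_space_axioms
      by (simp add: F_def bounded_functionals_def Vector_Spaces.linear_iff)
    then show ?thesis unfolding P_def by blast
  qed
  have P_comb: "(\<lambda>x. f x + c * g x) \<in> P" if fg: "f \<in> P" "g \<in> P" for f g c
  proof -
    obtain n1 N1 n2 N2 where "f \<in> F n1 N1" "g \<in> F n2 N2"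
      using fg unfolding P_def by blast
    then have f: "f \<in> F (max n1 n2) (max N1 N2)" and g: "g \<in> F (max n1 n2) (max N1 N2)"
      using F_mono by (meson max.cobounded1 max.cobounded2 subsetD)+
    obtain n N where nN: "f \<in> F n N" "g \<in> F n N" using f g by blast
    obtain M :: nat where M: "real N + norm c * real N \<le> real M"
      using real_arch_simple by blast
    have "norm (f x + c * g x) \<le> real M" if "x \<in> V n" for x
    proof -
      have "norm (f x) \<le> N" "norm (g x) \<le> N"
        using nN that unfolding F_def bounded_functionals_def by auto
      then have "norm (f x + c * g x) \<le> N + norm c * N"
        by (intro order_trans[OF norm_triangle_ineq] add_mono)
           (auto simp: norm_mult intro: mult_left_mono)
      with M show ?thesis by linarith
    qed
    moreover have "Vector_Spaces.linear sm (*) (\<lambda>x. f x + c * g x)"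
      using P_lin[OF fg(1)] P_lin[OF fg(2)] by (simp add: Vector_Spaces.linear_iff algebra_simps)
    ultimately have "(\<lambda>x. f x + c * g x) \<in> F n M"
      unfolding F_def bounded_functionals_def by simp
    then show ?thesis unfolding P_def by blast
  qed
  have P_sep: "\<exists>f\<in>P. f x \<noteq> 0" if x: "x \<noteq> 0" for x
  proof -
    obtain n N f where f: "f \<in> bounded_functionals sm (W n) N" "f x \<noteq> 0"
      using sep[OF x] by blast
    obtain M :: nat where "N \<le> real M" using real_arch_simple by blast
    have "norm (f y) \<le> real M" if "y \<in> V n" for y
    proof -
      have "norm (f y) \<le> N"
        using f(1) that unfolding bounded_functionals_def V_def by blast
      with \<open>N \<le> real M\<close> show ?thesis by linarith
    qed
    then have "f \<in> F n M" using f(1) unfolding F_def bounded_functionals_def by blast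
    with f(2) show ?thesis unfolding P_def by blast
  qed

  obtain D where D: "countable D" "T closure_of D = UNIV"
    using sepT unfolding separable_space_def topspace_UNIV by blast
  have "\<exists>S. countable S \<and> pointwise_dense_in S (F n N)" for n N
  proof (rule countable_pointwise_dense_subset[OF D(1)])
    fix x :: 'a and e :: real assume e: "e > 0"
    obtain Z where Z: "openin T Z" "x \<in> Z"
      "\<And>f y. f \<in> F n N \<Longrightarrow> y \<in> Z \<Longrightarrow> norm (f y - f x) < e"
      unfolding F_def
      by (rule bounded_functionals_equicontinuous[where x = x and N = "real N", OF V[of n] e]) blast
    have "x \<in> T closure_of D" using D(2) by simp
    then obtain d where "d \<in> D" "d \<in> Z" using Z(1,2) unfolding in_closure_of by blast
    with Z(3) show "\<exists>d\<in>D. \<forall>f\<in>F n N. norm (f d - f x) < e" by blast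
  qed
  then obtain S where S: "\<And>n N. countable (S n N)" "\<And>n N. pointwise_dense_in (S n N) (F n N)"
    by metis
  have S_F: "S n N \<subseteq> F n N" for n N using S(2) unfolding pointwise_dense_in_def by blast
  \<comment> \<open>On a finite set \<open>g\<close> agrees with some \<open>h\<close> in \<open>P\<close>, and \<open>h\<close> is approximated there from some \<open>S n N\<close>.\<close>
  let ?S = "\<Union>n N. S n N"
  have "?S \<inter> Z \<noteq> {}" if Z: "openin (weak_star_topology sm T) Z" "Z \<noteq> {}" for Z
  proof -
    obtain g where g: "g \<in> Z" using Z(2) by blast
    then have "g \<in> continuous_dual sm T" using openin_subset[OF Z(1)] by auto
    then have "Vector_Spaces.linear sm (*) g" by (simp add: continuous_dual_def)
    obtain B e where B: "finite B" and e: "e > 0"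
      and Be: "\<forall>f\<in>continuous_dual sm T. (\<forall>x\<in>B. norm (f x - g x) < e) \<longrightarrow> f \<in> Z"
      using weak_star_open_contains[OF Z(1) g] by (elim exE conjE)
    obtain h where "h \<in> P" "\<forall>x\<in>B. h x = g x"
      using separating_functionals_interpolate[OF P_lin P_zero P_comb P_sep
          \<open>Vector_Spaces.linear sm (*) g\<close> B] by blast
    moreover then obtain n N where "h \<in> F n N" unfolding P_def by blast
    ultimately obtain f where f: "f \<in> S n N" "\<forall>x\<in>B. norm (f x - g x) < e"
      using S(2)[of n N] B e unfolding pointwise_dense_in_def by metis
    with Be S_F F_dual have "f \<in> Z" by blast
    with f(1) show ?thesis by blast
  qed
  then have "weak_star_topology sm T closure_of ?S = topspace (weak_star_topology sm T)"
    by (simp only: dense_intersects_open) blast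
  moreover have "?S \<subseteq> topspace (weak_star_topology sm T)" using S_F F_dual by fastforce
  moreover have "countable ?S" using S(1) by blast
  ultimately show ?thesis unfolding separable_space_def by blast
qed

text \<open>
  The balls around \<open>0\<close> of a coarser metric are neighbourhoods of \<open>0\<close> that intersect in \<open>{0}\<close>, and each
  contains a convex neighbourhood. The sets \<open>C n\<close> need not be open, hence the open sets \<open>W n\<close> in them.
\<close>

lemma (in locally_convex_space) submetrizable_imp_convex_neighbourhood_sequence:
  assumes "submetrizable_space T"
  obtains W C :: "nat \<Rightarrow> 'a set"
  where "\<And>n. openin T (W n)" "\<And>n. 0 \<in> W n" "\<And>n. W n \<subseteq> C n" "\<And>n. convex_wrt sm (C n)"
    "(\<Inter>n. C n) = {0}"
proof -
  obtain R where R: "topspace R = UNIV" "metrizable_space R" "\<And>U. openin R U \<Longrightarrow> openin T U"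
    using assms unfolding submetrizable_space_def topspace_UNIV by blast
  obtain M d where M: "Metric_space M d" "R = Metric_space.mtopology M d"
    using R(2) unfolding metrizable_space_def by blast
  interpret Metric_space M d by fact
  have M_UNIV: "M = UNIV" using R(1) M(2) by simp
  let ?B = "\<lambda>n::nat. mball 0 (inverse (real (Suc n)))"
  have "\<exists>W C. openin T W \<and> convex_wrt sm C \<and> 0 \<in> W \<and> W \<subseteq> C \<and> C \<subseteq> ?B n" for n
  proof -
    have "openin T (?B n)" using R(3) M(2) by simp
    moreover have "0 \<in> ?B n" by (subst centre_in_mball_iff) (use M_UNIV in auto)
    ultimately show ?thesis
      using locally_convex unfolding neighbourhood_base_at_def by blast
  qed
  then obtain W C where WC: "openin T (W n)" "convex_wrt sm (C n)" "0 \<in> W n" "W n \<subseteq> C n"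
    "C n \<subseteq> ?B n" for n by metis
  have "x = 0" if x: "x \<in> (\<Inter>n. C n)" for x
  proof (rule ccontr)
    assume "x \<noteq> 0"
    then have "d 0 x > 0" using mdist_pos_less by (simp add: M_UNIV)
    then obtain n where "inverse (real (Suc n)) < d 0 x" using reals_Archimedean by blast
    moreover have "x \<in> ?B n" using x WC(5) by blast
    ultimately show False by simp
  qed
  then have "(\<Inter>n. C n) = {0}" using WC(3,4) by blast
  with that[of W C] WC show thesis by blast
qed

text \<open>
  Hahn--Banach bounds a functional on \<open>C\<close> only from one side. A bound on its absolute value holds at
  those points whose multiples by finitely many scalars lie in \<open>C\<close>: by \<open>\<plusminus>1\<close> in the real case, and
  also by \<open>\<plusminus>\<i>\<close> in the complex case. The set \<open>G\<close> of these scalars is a parameter, so that the two cases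
  differ only in the hypothesis \<open>HB\<close>. If \<open>C\<close> is a neighbourhood of \<open>0\<close>, these
  points form one as well, because \<open>G\<close> is finite.
\<close>

theorem separable_weak_star_if_convex_separation:
  fixes sm :: "'k::{real_normed_field, second_countable_topology} \<Rightarrow> 'a::ab_group_add \<Rightarrow> 'a"
    and G :: "'k set"
  assumes "locally_convex_space sm T" "separable_space T" and submet: "submetrizable_space T"
    and G: "finite G"
    and HB: "\<And>C x. convex_wrt sm C \<Longrightarrow> 0 \<in> C \<Longrightarrow> (\<And>y. \<exists>t>0. sm (of_real (1 / t)) y \<in> C) \<Longrightarrow>
        x \<notin> C \<Longrightarrow> \<exists>N. \<exists>f\<in>bounded_functionals sm {y. \<forall>c\<in>G. sm c y \<in> C} N. f x \<noteq> 0"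
  shows "separable_space (weak_star_topology sm T)"
proof -
  interpret locally_convex_space sm T by fact
  obtain W C :: "nat \<Rightarrow> 'a set" where WC: "\<And>n. openin T (W n)" "\<And>n. 0 \<in> W n" "\<And>n. W n \<subseteq> C n"
    "\<And>n. convex_wrt sm (C n)" "(\<Inter>n. C n) = {0}"
    using submetrizable_imp_convex_neighbourhood_sequence[OF submet] by blast
  define V where "V n = {y. \<forall>c\<in>G. sm c y \<in> W n}" for n
  show ?thesis
  proof (rule separable_weak_star_if_separating_neighbourhoods)
    show "topological_vector_space sm T" by unfold_locales
    show "separable_space T" by fact
    show "openin T (V n)" for n :: nat
    proof -
      have "openin T (\<Inter>c\<in>G. {y. sm c (y + 0) \<in> W n})" if "G \<noteq> {}"
        using G that openin_vimage_scale_translate[OF WC(1)] by (intro openin_INT2) blast+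
      moreover have "V n = (\<Inter>c\<in>G. {y. sm c (y + 0) \<in> W n})" by (auto simp: V_def)
      ultimately show ?thesis using openin_topspace[of T] topspace_UNIV by (cases "G = {}") auto
    qed
    show "0 \<in> V n" for n using WC(2) by (simp add: V_def)
  next
    fix x :: 'a assume "x \<noteq> 0"
    then obtain n where n: "x \<notin> C n" using WC(5) by blast
    have absorb: "\<exists>t>0. sm (of_real (1 / t)) y \<in> C n" for y
      using absorbing_zero_neighbourhood[OF WC(1)[of n] WC(2), of y] WC(3) by blast
    obtain N f where f: "f \<in> bounded_functionals sm {y. \<forall>c\<in>G. sm c y \<in> C n} N" "f x \<noteq> 0"
      using HB[OF WC(4) _ absorb n] WC(2,3) by blast
    moreover have "V n \<subseteq> {y. \<forall>c\<in>G. sm c y \<in> C n}" using WC(3) by (auto simp: V_def)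
    ultimately have "f \<in> bounded_functionals sm (V n) N"
      unfolding bounded_functionals_def by blast
    with f(2) show "\<exists>n N. \<exists>f\<in>bounded_functionals sm (V n) N. f x \<noteq> 0" by blast
  qed
qed

lemma real_convex_separation:
  fixes sm :: "real \<Rightarrow> 'a::ab_group_add \<Rightarrow> 'a"
  assumes "vector_space sm" "convex_wrt sm C" "0 \<in> C"
    and absorb: "\<And>y. \<exists>t>0. sm (of_real (1 / t)) y \<in> C" and "x \<notin> C"
  shows "\<exists>f\<in>bounded_functionals sm {y. \<forall>c\<in>{1, -1}. sm c y \<in> C} 1. f x \<noteq> 0"
proof -
  interpret vector_space sm by fact
  interpret real_scalar_space sm by unfold_locales
  have "\<exists>t>0. sm (1 / t) y \<in> C" for y using absorb[of y] by simp
  then obtain f where f: "\<And>x y. f (x + y) = f x + f y" "\<And>c x. f (sm c x) = c * f x"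
    "\<And>x. x \<in> C \<Longrightarrow> f x \<le> 1" "f x \<noteq> 0"
    using Hahn_Banach_convex[OF assms(2,3) _ assms(5)] by metis
  have "Vector_Spaces.linear sm (*) f"
    using f(1,2) vector_space_axioms vector_space_mult by (simp add: Vector_Spaces.linear_iff)
  moreover have "norm (f y) \<le> 1" if "sm 1 y \<in> C" "sm (-1) y \<in> C" for y
    using f(3)[OF that(1)] f(3)[OF that(2)] f(2) by (simp del: scale_one scale_minus_left)
  ultimately show ?thesis using f(4) unfolding bounded_functionals_def by blast
qed

text \<open>
  A real linear functional \<open>f\<close> is the real part of the complex linear functional
  \<open>g y = f y - \<i> f (\<i> y)\<close>. Bounds for \<open>f\<close> at \<open>\<plusminus>y\<close> and \<open>\<plusminus>\<i> y\<close> bound both parts of \<open>g y\<close>, hence the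
  constant \<open>2\<close>.
\<close>

lemma complex_convex_separation:
  fixes sm :: "complex \<Rightarrow> 'a::ab_group_add \<Rightarrow> 'a"
  assumes "vector_space sm" "convex_wrt sm C" "0 \<in> C"
    and absorb: "\<And>y. \<exists>t>0. sm (of_real (1 / t)) y \<in> C" and "x \<notin> C"
  shows "\<exists>f\<in>bounded_functionals sm {y. \<forall>c\<in>{1, -1, \<i>, -\<i>}. sm c y \<in> C} 2. f x \<noteq> 0"
proof -
  interpret vector_space sm by fact
  let ?sr = "\<lambda>r. sm (complex_of_real r)"
  interpret r: real_scalar_space ?sr
    by unfold_locales (auto simp: scale_right_distrib scale_left_distrib)
  have "convex_wrt ?sr C" using assms(2) unfolding convex_wrt_def by simp
  then obtain f where f: "\<And>x y. f (x + y) = f x + f y" "\<And>c x. f (?sr c x) = c * f x"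
    "\<And>x. x \<in> C \<Longrightarrow> f x \<le> 1" "f x \<noteq> 0"
    using r.Hahn_Banach_convex[OF _ assms(3) absorb assms(5)] by metis
  define g where "g y = Complex (f y) (- f (sm \<i> y))" for y
  have f_neg: "f (sm (-1) y) = - f y" for y using f(2)[of "-1" y] by simp
  have f_neg': "f (- y) = - f y" for y using f_neg[of y] by simp
  have f_scale: "f (sm c y) = Re c * f y + Im c * f (sm \<i> y)" for c y
  proof -
    have "sm c y = ?sr (Re c) y + ?sr (Im c) (sm \<i> y)"
      by (subst complex_eq[of c]) (simp add: scale_left_distrib mult.commute)
    then have "f (sm c y) = f (?sr (Re c) y) + f (?sr (Im c) (sm \<i> y))" by (simp only: f(1))
    then show ?thesis by (simp only: f(2))
  qed
  have g_scale: "g (sm c y) = c * g y" for c y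
    using f_scale[of c y] f_scale[of "\<i> * c" y]
    by (simp add: g_def complex_eq_iff algebra_simps)
  have g_add: "g (y + z) = g y + g z" for y z
    by (simp add: g_def complex_eq_iff scale_right_distrib f(1))
  have "Vector_Spaces.linear sm (*) g"
    using g_add g_scale vector_space_axioms vector_space_mult by (simp add: Vector_Spaces.linear_iff)
  moreover have "norm (g y) \<le> 2" if "\<forall>c\<in>{1, -1, \<i>, -\<i>}. sm c y \<in> C" for y
  proof -
    have "f y \<le> 1" "- f y \<le> 1" "f (sm \<i> y) \<le> 1" "- f (sm \<i> y) \<le> 1"
      using f(3)[of y] f(3)[of "- y"] f(3)[of "sm \<i> y"] f(3)[of "- sm \<i> y"] that
      by (auto simp: f_neg')
    then have "\<bar>Re (g y)\<bar> + \<bar>Im (g y)\<bar> \<le> 2" by (simp add: g_def)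
    with cmod_le[of "g y"] show ?thesis by linarith
  qed
  moreover have "g x \<noteq> 0" using f(4) by (simp add: g_def complex_eq_iff)
  ultimately show ?thesis unfolding bounded_functionals_def by blast
qed

theorem corollary3p6:
  fixes T :: "'a::ab_group_add topology"
    and scaleR' :: "real \<Rightarrow> 'a \<Rightarrow> 'a"
    and scaleC' :: "complex \<Rightarrow> 'a \<Rightarrow> 'a"
  shows "(locally_convex_space scaleR' T \<and> Hausdorff_space T \<and>
            separable_space T \<and> submetrizable_space T
          \<longrightarrow> separable_space (weak_star_topology scaleR' T)) \<and>
         (locally_convex_space scaleC' T \<and> Hausdorff_space T \<and>
            separable_space T \<and> submetrizable_space T
          \<longrightarrow> separable_space (weak_star_topology scaleC' T))"
proof (intro conjI impI; elim conjE)
  assume T: "locally_convex_space scaleR' T" "separable_space T" "submetrizable_space T"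
  have "vector_space scaleR'"
    using T(1) unfolding locally_convex_space_def topological_vector_space_def by blast
  then show "separable_space (weak_star_topology scaleR' T)"
    using separable_weak_star_if_convex_separation[OF T, of "{1, -1}"] real_convex_separation
    by blast
next
  assume T: "locally_convex_space scaleC' T" "separable_space T" "submetrizable_space T"
  have "vector_space scaleC'"
    using T(1) unfolding locally_convex_space_def topological_vector_space_def by blast
  then show "separable_space (weak_star_topology scaleC' T)"
    using separable_weak_star_if_convex_separation[OF T, of "{1, -1, \<i>, -\<i>}"]
      complex_convex_separation by blast
qed

end
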